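(* Every commutative semiprime monoartinian ring is a Goldie ring.
   Context: Rings are associative with identity. A module $A$ is embedded in a module $B$ if there is an injective homomorphism $A\to B$. A module $M$ is monoartinian if for every descending chain $M_1\supseteq M_2\supseteq\cdots$ of submodules of $M$ there exists $n\ge1$ such that $M_n$ is embedded in $M_i$ for every $i\ge n$. A (commutative) ring $R$ is monoartinian if $R$ is monoartinian as a module over itself. A commutative ring is Goldie if it has finite uniform dimension as a module over itself and satisfies the ascending chain condition on annihilator ideals. *)

theory Defs
  imports "HOL-Algebra.Module" "HOL-Algebra.Ideal_Product"
begin

definition module_hom ::
  "('r, 'm) ring_scheme \<Rightarrow> ('r, 'a, 'c) module_scheme \<Rightarrow> ('r, 'b, 'd) module_scheme \<Rightarrow> ('a \<Rightarrow> 'b) set"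
  where "module_hom R A B =
    {f \<in> hom (add_monoid A) (add_monoid B).
      \<forall>r\<in>carrier R. \<forall>x\<in>carrier A. f (r \<odot>\<^bsub>A\<^esub> x) = r \<odot>\<^bsub>B\<^esub> f x}"

definition module_embedded ::
  "('r, 'm) ring_scheme \<Rightarrow> ('r, 'a, 'c) module_scheme \<Rightarrow> ('r, 'b, 'd) module_scheme \<Rightarrow> bool"
  where "module_embedded R A B \<longleftrightarrow> (\<exists>f\<in>module_hom R A B. inj_on f (carrier A))"

text \<open>Chains are indexed from 0; the predicates on modules below are meant for \<^term>\<open>M\<close> with
  \<^prop>\<open>module R M\<close>. A submodule \<^term>\<open>N\<close> is a subset of the carrier; as a module in its
  own right it is \<^term>\<open>M\<lparr>carrier := N\<rparr>\<close>.\<close>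

definition monoartinian_module ::
  "('r, 'm) ring_scheme \<Rightarrow> ('r, 'a, 'c) module_scheme \<Rightarrow> bool"
  where "monoartinian_module R M \<longleftrightarrow>
    (\<forall>N :: nat \<Rightarrow> 'a set.
      (\<forall>i. submodule (N i) R M) \<and> (\<forall>i. N (Suc i) \<subseteq> N i) \<longrightarrow>
      (\<exists>n. \<forall>i\<ge>n. module_embedded R (M\<lparr>carrier := N n\<rparr>) (M\<lparr>carrier := N i\<rparr>)))"

definition self_module :: "('a, 'm) ring_scheme \<Rightarrow> ('a, 'a) module"
  where "self_module R =
    \<lparr>carrier = carrier R, mult = mult R, one = one R, zero = zero R, add = add R, smult = mult R\<rparr>"

definition monoartinian_ring :: "('a, 'm) ring_scheme \<Rightarrow> bool"
  where "monoartinian_ring R \<longleftrightarrow> monoartinian_module R (self_module R)"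

text \<open>No nonzero nilpotent ideals. The power is the iterated ideal product; the exponent 0 gives
  the whole ring, which is zero only if every ideal is.\<close>

definition semiprime_ring :: "('a, 'm) ring_scheme \<Rightarrow> bool"
  where "semiprime_ring R \<longleftrightarrow>
    (\<forall>I. ideal I R \<and> (\<exists>n::nat. I [^]\<^bsub>ideals_set R\<^esub> n = {\<zero>\<^bsub>R\<^esub>}) \<longrightarrow> I = {\<zero>\<^bsub>R\<^esub>})"

definition essential_submodule ::
  "'a set \<Rightarrow> ('r, 'm) ring_scheme \<Rightarrow> ('r, 'a, 'c) module_scheme \<Rightarrow> bool"
  where "essential_submodule N R M \<longleftrightarrow> submodule N R M \<and>
    (\<forall>K. submodule K R M \<and> K \<noteq> {\<zero>\<^bsub>M\<^esub>} \<longrightarrow> K \<inter> N \<noteq> {\<zero>\<^bsub>M\<^esub>})"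

definition uniform_module ::
  "('r, 'm) ring_scheme \<Rightarrow> ('r, 'a, 'c) module_scheme \<Rightarrow> bool"
  where "uniform_module R M \<longleftrightarrow> carrier M \<noteq> {\<zero>\<^bsub>M\<^esub>} \<and>
    (\<forall>A B. submodule A R M \<and> submodule B R M \<and> A \<noteq> {\<zero>\<^bsub>M\<^esub>} \<and> B \<noteq> {\<zero>\<^bsub>M\<^esub>} \<longrightarrow>
      A \<inter> B \<noteq> {\<zero>\<^bsub>M\<^esub>})"

definition submodule_sum :: "('r, 'a, 'c) module_scheme \<Rightarrow> 'i set \<Rightarrow> ('i \<Rightarrow> 'a set) \<Rightarrow> 'a set"
  where "submodule_sum M I U = (\<lambda>x. finsum M x I) ` (Pi I U)"

definition independent_submodules ::
  "('r, 'a, 'c) module_scheme \<Rightarrow> 'i set \<Rightarrow> ('i \<Rightarrow> 'a set) \<Rightarrow> bool"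
  where "independent_submodules M I U \<longleftrightarrow>
    (\<forall>x\<in>Pi I U. finsum M x I = \<zero>\<^bsub>M\<^esub> \<longrightarrow> (\<forall>i\<in>I. x i = \<zero>\<^bsub>M\<^esub>))"

text \<open>\<^term>\<open>M\<close> has uniform dimension \<^term>\<open>n\<close> if it has an essential submodule that is an
  internal direct sum of \<^term>\<open>n\<close> uniform submodules.\<close>

definition has_uniform_dimension ::
  "('r, 'm) ring_scheme \<Rightarrow> ('r, 'a, 'c) module_scheme \<Rightarrow> nat \<Rightarrow> bool"
  where "has_uniform_dimension R M n \<longleftrightarrow>
    (\<exists>U :: nat \<Rightarrow> 'a set.
      (\<forall>i<n. submodule (U i) R M \<and> uniform_module R (M\<lparr>carrier := U i\<rparr>)) \<and>
      independent_submodules M {..<n} U \<and>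
      essential_submodule (submodule_sum M {..<n} U) R M)"

definition finite_uniform_dimension ::
  "('r, 'm) ring_scheme \<Rightarrow> ('r, 'a, 'c) module_scheme \<Rightarrow> bool"
  where "finite_uniform_dimension R M \<longleftrightarrow> (\<exists>n. has_uniform_dimension R M n)"

text \<open>For commutative rings, so left and right annihilators agree.\<close>

definition annihilator :: "('a, 'm) ring_scheme \<Rightarrow> 'a set \<Rightarrow> 'a set"
  where "annihilator R S = {r \<in> carrier R. \<forall>s\<in>S. r \<otimes>\<^bsub>R\<^esub> s = \<zero>\<^bsub>R\<^esub>}"

definition annihilator_ideal :: "('a, 'm) ring_scheme \<Rightarrow> 'a set \<Rightarrow> bool"
  where "annihilator_ideal R I \<longleftrightarrow> (\<exists>S\<subseteq>carrier R. I = annihilator R S)"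

definition acc_annihilator_ideals :: "('a, 'm) ring_scheme \<Rightarrow> bool"
  where "acc_annihilator_ideals R \<longleftrightarrow>
    (\<forall>A :: nat \<Rightarrow> 'a set.
      (\<forall>i. annihilator_ideal R (A i)) \<and> (\<forall>i. A i \<subseteq> A (Suc i)) \<longrightarrow>
      (\<exists>n. \<forall>i\<ge>n. A i = A n))"

definition goldie_ring :: "('a, 'm) ring_scheme \<Rightarrow> bool"
  where "goldie_ring R \<longleftrightarrow>
    finite_uniform_dimension R (self_module R) \<and> acc_annihilator_ideals R"

lemma (in cring) self_module_is_module: "module R (self_module R)"
proof (rule moduleI)
  show "cring R" by (rule is_cring)
  show "abelian_group (self_module R)"
  proof (rule abelian_groupI)
    show "\<exists>y\<in>carrier (self_module R). y \<oplus>\<^bsub>self_module R\<^esub> x = \<zero>\<^bsub>self_module R\<^esub>"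
      if "x \<in> carrier (self_module R)" for x
      using that by (auto simp: self_module_def intro: l_neg)
  qed (auto simp: self_module_def a_ac)
qed (auto simp: self_module_def l_distr r_distr m_assoc)

lemma (in cring) submodule_self_module_iff:
  "submodule I R (self_module R) \<longleftrightarrow> ideal I R"
proof -
  have add: "subgroup I (add_monoid (self_module R)) \<longleftrightarrow> subgroup I (add_monoid R)"
    by (simp add: self_module_def subgroup_def m_inv_def)
  show ?thesis
  proof
    assume I: "submodule I R (self_module R)"
    then have sub: "subgroup I (add_monoid R)"
      using add by (simp add: submodule_def)
    have closed: "a \<otimes> x \<in> I" if "a \<in> carrier R" "x \<in> I" for a x
      using submodule.smult_closed[OF I that] by (simp add: self_module_def)
    show "ideal I R"
    proof (rule idealI)
      show "ring R" by (rule ring_axioms)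
      show "x \<otimes> a \<in> I" if "a \<in> I" "x \<in> carrier R" for a x
        using closed that by simp
      show "a \<otimes> x \<in> I" if "a \<in> I" "x \<in> carrier R" for a x
        using closed[OF that(2,1)] that subgroup.mem_carrier[OF sub]
        by (simp add: m_comm)
    qed (rule sub)
  next
    assume I: "ideal I R"
    then show "submodule I R (self_module R)"
      unfolding submodule_def submodule_axioms_def add
      by (auto simp: self_module_def additive_subgroup.a_subgroup ideal.axioms(1)
          intro: ideal.I_l_closed)
  qed
qed

end

theory Submission
  imports Defs
begin

text \<open>An embedding of an ideal \<open>I\<close> into an ideal \<open>J \<subseteq> I\<close> forces \<open>I\<close> and \<open>J\<close> to have the same
  annihilator. Since an annihilator ideal is its own double annihilator, a descending chain of
  annihilator ideals in a monoartinian ring stabilises, and so, by taking annihilators, does an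
  ascending one. In a reduced ring with this property the minimal nonzero annihilator ideals are
  uniform, annihilate each other pairwise, are finite in number, and every nonzero ideal meets one
  of them, so their sum is direct and essential.\<close>

context cring
begin

section \<open>Ideals, annihilators and double annihilators\<close>

lemma idealI_closed:
  assumes carr: "I \<subseteq> carrier R" and zero: "\<zero> \<in> I"
    and add: "\<And>x y. x \<in> I \<Longrightarrow> y \<in> I \<Longrightarrow> x \<oplus> y \<in> I"
    and mult: "\<And>r x. r \<in> carrier R \<Longrightarrow> x \<in> I \<Longrightarrow> r \<otimes> x \<in> I"
  shows "ideal I R"
proof (rule idealI)
  show "subgroup I (add_monoid R)"
  proof
    fix x assume x: "x \<in> I"
    then have "\<ominus> \<one> \<otimes> x = \<ominus> x"
      using carr by (auto simp: l_minus)
    then show "inv\<^bsub>add_monoid R\<^esub> x \<in> I"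
      using mult[OF _ x, of "\<ominus> \<one>"] by (simp add: a_inv_def)
  qed (use assms in auto)
next
  fix a x assume "a \<in> I" "x \<in> carrier R"
  then show "x \<otimes> a \<in> I" "a \<otimes> x \<in> I"
    using mult carr by (auto simp: m_comm[of a x] subset_eq)
qed (rule ring_axioms)

lemma ideal_zero_mem: "ideal I R \<Longrightarrow> \<zero> \<in> I"
  by (simp add: additive_subgroup.zero_closed ideal.axioms(1))

lemma annihilator_is_ideal:
  assumes "S \<subseteq> carrier R"
  shows "ideal (annihilator R S) R"
  using assms by (intro idealI_closed) (auto simp: annihilator_def l_distr m_assoc subset_eq)

lemma annihilator_ideal_is_ideal: "annihilator_ideal R I \<Longrightarrow> ideal I R"
  using annihilator_is_ideal by (auto simp: annihilator_ideal_def)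

lemma annihilator_antimono: "S \<subseteq> T \<Longrightarrow> annihilator R T \<subseteq> annihilator R S"
  by (auto simp: annihilator_def)

lemma annihilator_subset: "annihilator R S \<subseteq> carrier R"
  by (auto simp: annihilator_def)

lemma subset_annihilator_annihilator:
  assumes "S \<subseteq> carrier R"
  shows "S \<subseteq> annihilator R (annihilator R S)"
  using assms by (auto simp: annihilator_def m_comm subset_eq)

text \<open>Galois connection: if \<open>I\<close> is the annihilator of \<open>S\<close>, then
  \<open>S\<close> annihilates \<open>I\<close>, and taking annihilators reverses that
  inclusion.\<close>

lemma annihilator_annihilator:
  assumes "annihilator_ideal R I"
  shows "annihilator R (annihilator R I) = I"
proof -
  obtain S where S: "S \<subseteq> carrier R" "I = annihilator R S"
    using assms by (auto simp: annihilator_ideal_def)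
  have "annihilator R (annihilator R I) \<subseteq> I"
    unfolding S(2) by (intro annihilator_antimono subset_annihilator_annihilator S)
  then show ?thesis
    using subset_annihilator_annihilator[OF annihilator_subset[of S]] S by blast
qed

lemma annihilator_ideal_inter:
  assumes "annihilator_ideal R I" "annihilator_ideal R J"
  shows "annihilator_ideal R (I \<inter> J)"
proof -
  obtain S T where ST: "S \<subseteq> carrier R" "I = annihilator R S" "T \<subseteq> carrier R" "J = annihilator R T"
    using assms by (auto simp: annihilator_ideal_def)
  then have "I \<inter> J = annihilator R (S \<union> T)" "S \<union> T \<subseteq> carrier R"
    by (auto simp: annihilator_def)
  then show ?thesis
    unfolding annihilator_ideal_def by blast
qed

lemma annihilator_ideal_annihilator:
  "S \<subseteq> carrier R \<Longrightarrow> annihilator_ideal R (annihilator R S)"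
  unfolding annihilator_ideal_def by blast

section \<open>Chain conditions from the monoartinian property\<close>

text \<open>If \<open>r\<close> kills \<open>J\<close>, then
  \<open>f (r \<otimes> s) = r \<otimes> f s = \<zero>\<close> for \<open>s\<close> in
  \<open>I\<close>, and injectivity of the embedding \<open>f\<close> gives
  \<open>r \<otimes> s = \<zero>\<close>.\<close>

lemma annihilator_subset_if_module_embedded:
  assumes I: "ideal I R" and J: "ideal J R"
    and emb: "module_embedded R ((self_module R)\<lparr>carrier := I\<rparr>) ((self_module R)\<lparr>carrier := J\<rparr>)"
  shows "annihilator R J \<subseteq> annihilator R I"
proof
  interpret I: ideal I R by (rule I)
  interpret J: ideal J R by (rule J)
  obtain f where f: "inj_on f I" "\<And>x. x \<in> I \<Longrightarrow> f x \<in> J"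
      "\<And>r x. r \<in> carrier R \<Longrightarrow> x \<in> I \<Longrightarrow> f (r \<otimes> x) = r \<otimes> f x"
    using emb unfolding module_embedded_def module_hom_def hom_def self_module_def by fastforce
  have f0: "f \<zero> = \<zero>"
    using f(3)[of \<zero> \<zero>] f(2)[of \<zero>] by simp
  fix r assume r: "r \<in> annihilator R J"
  have "r \<otimes> s = \<zero>" if s: "s \<in> I" for s
  proof -
    have rs: "r \<in> carrier R" "r \<otimes> s \<in> I"
      using r s by (auto simp: annihilator_def I.I_l_closed)
    have "f (r \<otimes> s) = f \<zero>"
      using f(2)[OF s] f(3)[OF rs(1) s] r f0 by (simp add: annihilator_def)
    then show ?thesis
      using f(1) rs(2) by (auto dest: inj_onD)
  qed
  then show "r \<in> annihilator R I"
    using r by (simp add: annihilator_def)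
qed

lemma monoartinian_annihilator_dcc:
  assumes "monoartinian_ring R"
    and A: "\<And>i::nat. annihilator_ideal R (A i)" and dec: "\<And>i. A (Suc i) \<subseteq> A i"
  shows "\<exists>n. \<forall>i\<ge>n. A i = A n"
proof -
  have ideals: "ideal (A i) R" for i
    using A by (rule annihilator_ideal_is_ideal)
  obtain n where n: "\<And>i. i \<ge> n \<Longrightarrow> module_embedded R
      ((self_module R)\<lparr>carrier := A n\<rparr>) ((self_module R)\<lparr>carrier := A i\<rparr>)"
    using assms(1) ideals dec
    unfolding monoartinian_ring_def monoartinian_module_def submodule_self_module_iff by blast
  have "A i = A n" if "i \<ge> n" for i
  proof -
    \<comment> \<open>The embedding of \<open>A n\<close> into \<open>A i\<close> compares their
      annihilators; annihilating once more recovers the ideals themselves.\<close>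
    have "A n \<subseteq> A i"
      using annihilator_antimono[OF annihilator_subset_if_module_embedded[OF ideals ideals n[OF that]]]
      by (simp add: annihilator_annihilator A)
    then show ?thesis
      using lift_Suc_antimono_le[of A, OF dec that] by blast
  qed
  then show ?thesis by blast
qed

text \<open>The annihilators of an ascending chain descend, hence stabilise, and double annihilators
  carry this back to the chain.\<close>

lemma monoartinian_acc_annihilator_ideals:
  assumes "monoartinian_ring R"
  shows "acc_annihilator_ideals R"
  unfolding acc_annihilator_ideals_def
proof (intro allI impI, elim conjE)
  fix A :: "nat \<Rightarrow> 'a set"
  assume A: "\<forall>i. annihilator_ideal R (A i)" and inc: "\<forall>i. A i \<subseteq> A (Suc i)"
  have "A i \<subseteq> carrier R" for i
    using A annihilator_subset unfolding annihilator_ideal_def by metis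
  then obtain n where "\<forall>i\<ge>n. annihilator R (A i) = annihilator R (A n)"
    using monoartinian_annihilator_dcc[OF assms, of "\<lambda>i. annihilator R (A i)"] inc
    by (meson annihilator_ideal_annihilator annihilator_antimono)
  then have "\<forall>i\<ge>n. A i = A n"
    by (metis A annihilator_annihilator)
  then show "\<exists>n. \<forall>i\<ge>n. A i = A n" ..
qed

section \<open>From semiprime to reduced\<close>

text \<open>By commutativity, an element of square zero generates a principal ideal of square
  zero.\<close>

lemma semiprime_imp_reduced:
  assumes "semiprime_ring R" and x: "x \<in> carrier R" "x \<otimes> x = \<zero>"
  shows "x = \<zero>"
proof -
  let ?I = "PIdl x"
  interpret I: ideal ?I R by (rule cgenideal_ideal[OF x(1)])
  have prod0: "a \<otimes> b = \<zero>" if ab: "a \<in> ?I" "b \<in> ?I" for a b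
  proof -
    obtain r s where rs: "r \<in> carrier R" "s \<in> carrier R" "a = r \<otimes> x" "b = s \<otimes> x"
      using ab unfolding cgenideal_def by blast
    then have "a \<otimes> b = (r \<otimes> s) \<otimes> (x \<otimes> x)"
      using x(1) by (simp add: m_ac)
    then show ?thesis
      using x rs by simp
  qed
  have "z = \<zero>" if "z \<in> ?I \<cdot> ?I" for z
    using that by (induction rule: ideal_prod.induct) (auto simp: prod0)
  moreover have "\<zero> \<in> ?I \<cdot> ?I"
    using ideal_prod.prod[of \<zero> ?I \<zero> ?I R] by simp
  ultimately have "?I \<cdot> ?I = {\<zero>}"
    by blast
  \<comment> \<open>The iterated product starts with the unit \<open>carrier R\<close>; commuting it
    past \<open>?I\<close> lets the unit law absorb it.\<close>
  moreover have "?I [^]\<^bsub>ideals_set R\<^esub> (2::nat) = ?I \<cdot> ?I"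
    using ideal_prod_one[OF I.is_ideal] ideal_prod_commute[OF I.is_ideal oneideal]
    by (simp add: ideals_set_def numeral_2_eq_2)
  ultimately have "?I = {\<zero>}"
    using assms(1) I.is_ideal unfolding semiprime_ring_def by metis
  then show ?thesis
    using cgenideal_self[OF x(1)] by simp
qed

section \<open>Submodules of ideals and sums of ideals\<close>

text \<open>Reduces uniformity of \<open>U\<close>, a statement about submodules of
  \<open>U\<close>, to one about ideals of the ring inside \<open>U\<close>.\<close>

lemma ideal_if_submodule_of_ideal:
  assumes U: "ideal U R" and A: "submodule A R ((self_module R)\<lparr>carrier := U\<rparr>)"
  shows "ideal A R" "A \<subseteq> U"
proof -
  interpret U: ideal U R by (rule U)
  interpret A: submodule A R "(self_module R)\<lparr>carrier := U\<rparr>" by (rule A)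
  show sub: "A \<subseteq> U"
    using A.subset by simp
  show "ideal A R"
  proof (rule idealI_closed)
    show "A \<subseteq> carrier R"
      using sub U.a_subset by blast
    \<comment> \<open>A submodule is a subgroup of the additive monoid, so \<open>one_closed\<close>
      and \<open>m_closed\<close> speak of zero and of sums.\<close>
    show "\<zero> \<in> A" "\<And>x y. x \<in> A \<Longrightarrow> y \<in> A \<Longrightarrow> x \<oplus> y \<in> A"
      using A.one_closed A.m_closed by (auto simp: self_module_def)
    show "r \<otimes> x \<in> A" if "r \<in> carrier R" "x \<in> A" for r x
      using A.smult_closed[OF that] by (simp add: self_module_def)
  qed
qed

lemma finsum_self_module: "finsum (self_module R) f I = finsum R f I"
  by (simp add: finsum_def finprod_def self_module_def)

lemma submodule_sum_self_module_is_ideal: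
  assumes "finite I" and U: "\<And>i. i \<in> I \<Longrightarrow> ideal (U i) R"
  shows "ideal (submodule_sum (self_module R) I U) R" (is "ideal ?S R")
proof -
  have carr: "x \<in> I \<rightarrow> carrier R" if "x \<in> Pi I U" for x
    using that U by (meson Pi_I' Pi_mem ideal.Icarr)
  have S: "?S = (\<lambda>x. finsum R x I) ` Pi I U"
    by (simp add: submodule_sum_def finsum_self_module)
  show ?thesis
  proof (rule idealI_closed)
    show "?S \<subseteq> carrier R"
      using carr by (auto simp: S)
    have "(\<lambda>i. \<zero>) \<in> Pi I U"
      using U by (auto intro: ideal_zero_mem)
    then show "\<zero> \<in> ?S"
      unfolding S by (rule rev_image_eqI) simp
  next
    fix a b assume "a \<in> ?S" "b \<in> ?S"
    then obtain x y where xy: "x \<in> Pi I U" "y \<in> Pi I U" "a = finsum R x I" "b = finsum R y I"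
      unfolding S by blast
    then have "(\<lambda>i. x i \<oplus> y i) \<in> Pi I U"
      using U by (auto intro!: additive_subgroup.a_closed ideal.axioms(1))
    then show "a \<oplus> b \<in> ?S"
      unfolding S xy by (rule rev_image_eqI) (simp add: carr xy finsum_addf)
  next
    fix r a assume r: "r \<in> carrier R" and "a \<in> ?S"
    then obtain x where x: "x \<in> Pi I U" "a = finsum R x I"
      unfolding S by blast
    then have "(\<lambda>i. r \<otimes> x i) \<in> Pi I U"
      using U r by (auto intro!: ideal.I_l_closed)
    then show "r \<otimes> a \<in> ?S"
      unfolding S x(2) using \<open>finite I\<close> r carr x(1)
      by (intro rev_image_eqI) (auto simp: finsum_rdistr)
  qed
qed

lemma ideal_subset_submodule_sum:
  assumes "finite I" and U: "\<And>i. i \<in> I \<Longrightarrow> ideal (U i) R" and j: "j \<in> I"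
  shows "U j \<subseteq> submodule_sum (self_module R) I U"
proof
  fix u assume u: "u \<in> U j"
  \<comment> \<open>The family concentrated at \<open>j\<close>, with the test oriented as in
    \<open>finsum_singleton\<close>.\<close>
  let ?x = "\<lambda>i. if j = i then u else \<zero>"
  have "?x \<in> Pi I U"
    using u by (simp add: Pi_def U ideal_zero_mem)
  moreover have "finsum R ?x I = u"
    using finsum_singleton[OF j \<open>finite I\<close>, of "\<lambda>_. u"] ideal.Icarr[OF U[OF j] u] by simp
  ultimately show "u \<in> submodule_sum (self_module R) I U"
    by (force simp: submodule_sum_def finsum_self_module)
qed

text \<open>A product of an element of \<open>I\<close> and one of \<open>J\<close> lies in both
  ideals.\<close>

lemma ideal_inter_zero_imp_annihilator:
  assumes I: "ideal I R" and J: "ideal J R" and "I \<inter> J \<subseteq> {\<zero>}"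
  shows "I \<subseteq> annihilator R J"
proof -
  have "x \<otimes> y = \<zero>" if "x \<in> I" "y \<in> J" for x y
    using assms that ideal.Icarr[OF I] ideal.Icarr[OF J]
      ideal.I_r_closed[OF I] ideal.I_l_closed[OF J] by blast
  then show ?thesis
    using ideal.Icarr[OF I] by (auto simp: annihilator_def)
qed

section \<open>Minimal nonzero annihilator ideals\<close>

text \<open>Minimality is among annihilator ideals because the descending chain condition holds for
  these; the integers have no minimal nonzero ideal at all.\<close>

definition min_annihilator :: "'a set \<Rightarrow> bool" where
  "min_annihilator U \<longleftrightarrow> annihilator_ideal R U \<and> U \<noteq> {\<zero>} \<and>
    (\<forall>V. annihilator_ideal R V \<and> V \<subseteq> U \<and> V \<noteq> {\<zero>} \<longrightarrow> V = U)"

lemma min_annihilator_is_ideal: "min_annihilator U \<Longrightarrow> ideal U R"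
  by (simp add: min_annihilator_def annihilator_ideal_is_ideal)

text \<open>The intersection is again an annihilator ideal, so if nonzero it would equal both
  \<open>U\<close> and \<open>V\<close>.\<close>

lemma min_annihilator_disjoint:
  assumes "min_annihilator U" "min_annihilator V" "U \<noteq> V"
  shows "U \<inter> V = {\<zero>}"
  using assms annihilator_ideal_inter[of U V] unfolding min_annihilator_def
  by (metis inf_le1 inf_le2)

lemma min_annihilator_mult_zero:
  assumes U: "min_annihilator U" and V: "min_annihilator V" and "U \<noteq> V"
    and xy: "x \<in> U" "y \<in> V"
  shows "x \<otimes> y = \<zero>"
  using ideal_inter_zero_imp_annihilator[OF U[THEN min_annihilator_is_ideal]
      V[THEN min_annihilator_is_ideal]] min_annihilator_disjoint[OF U V \<open>U \<noteq> V\<close>] xy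
  by (auto simp: annihilator_def)

context
  assumes reduced: "\<And>x. x \<in> carrier R \<Longrightarrow> x \<otimes> x = \<zero> \<Longrightarrow> x = \<zero>"
begin

text \<open>Every element of \<open>I\<close> annihilates \<open>J\<close>, hence itself, so it has
  square zero.\<close>

lemma ideal_subset_annihilator_imp_zero:
  assumes I: "ideal I R" and "I \<subseteq> annihilator R J" "I \<subseteq> J"
  shows "I = {\<zero>}"
  using assms(2,3) reduced ideal_zero_mem[OF I] by (auto simp: annihilator_def subset_eq)

text \<open>If \<open>A\<close> and \<open>B\<close> met trivially, \<open>A\<close> would lie in
  the annihilator of \<open>B\<close>. That annihilator would then meet \<open>U\<close>
  nontrivially, so contain \<open>U\<close> by minimality, and \<open>B\<close> would annihilate
  itself.\<close>

lemma min_annihilator_uniform: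
  assumes U: "min_annihilator U"
  shows "uniform_module R ((self_module R)\<lparr>carrier := U\<rparr>)"
proof -
  note Ui = min_annihilator_is_ideal[OF U]
  have "A \<inter> B \<noteq> {\<zero>}" if A: "ideal A R" "A \<subseteq> U" "A \<noteq> {\<zero>}" and B: "ideal B R" "B \<subseteq> U" "B \<noteq> {\<zero>}"
    for A B
  proof
    assume "A \<inter> B = {\<zero>}"
    then have AB: "A \<subseteq> annihilator R B"
      by (intro ideal_inter_zero_imp_annihilator A B) simp
    let ?V = "annihilator R B \<inter> U"
    have "annihilator_ideal R ?V"
      using U ideal.Icarr[OF B(1)]
      by (intro annihilator_ideal_inter annihilator_ideal_annihilator) (auto simp: min_annihilator_def)
    moreover have "?V \<noteq> {\<zero>}"
      using AB A ideal_zero_mem[OF A(1)] by blast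
    ultimately have "?V = U"
      using U unfolding min_annihilator_def by blast
    then show False
      using ideal_subset_annihilator_imp_zero[OF B(1), of B] B by blast
  qed
  then show ?thesis
    using U ideal_if_submodule_of_ideal[OF Ui]
    by (simp add: uniform_module_def min_annihilator_def self_module_def)
qed

text \<open>Multiplying a vanishing sum by \<open>x j\<close> kills every term except the square of
  \<open>x j\<close>, and reducedness gives \<open>x j = \<zero>\<close>.\<close>

lemma min_annihilators_independent:
  assumes "finite I" and U: "\<And>i. i \<in> I \<Longrightarrow> min_annihilator (U i)" and inj: "inj_on U I"
  shows "independent_submodules (self_module R) I U"
  unfolding independent_submodules_def
proof (intro ballI impI)
  fix x j assume x: "x \<in> Pi I U" and sum: "finsum (self_module R) x I = \<zero>\<^bsub>self_module R\<^esub>"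
    and j: "j \<in> I"
  have carr: "x i \<in> carrier R" if "i \<in> I" for i
    using that x U min_annihilator_is_ideal ideal.Icarr by (meson Pi_mem)
  have "x j \<otimes> x i = (if j = i then x i \<otimes> x i else \<zero>)" if "i \<in> I" for i
    using min_annihilator_mult_zero[OF U[OF j] U[OF that]] inj_onD[OF inj _ j that]
      Pi_mem[OF x j] Pi_mem[OF x that] by auto
  then have "(\<Oplus>i\<in>I. x j \<otimes> x i) = (\<Oplus>i\<in>I. if j = i then x i \<otimes> x i else \<zero>)"
    using carr by (intro finsum_cong') auto
  also have "\<dots> = x j \<otimes> x j"
    using finsum_singleton[OF j \<open>finite I\<close>, of "\<lambda>i. x i \<otimes> x i"] carr by auto
  finally have "x j \<otimes> x j = x j \<otimes> finsum R x I"
    using finsum_rdistr[OF \<open>finite I\<close>, of "x j" x] carr j by auto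
  also have "\<dots> = \<zero>"
    using sum carr[OF j] by (simp add: finsum_self_module) (simp add: self_module_def)
  finally show "x j = \<zero>\<^bsub>self_module R\<^esub>"
    using reduced[OF carr[OF j]] by (simp add: self_module_def)
qed

section \<open>Existence, finiteness and essentiality from the chain condition\<close>

context
  assumes dcc: "\<And>A :: nat \<Rightarrow> 'a set. (\<And>i. annihilator_ideal R (A i)) \<Longrightarrow>
    (\<And>i. A (Suc i) \<subseteq> A i) \<Longrightarrow> \<exists>n. \<forall>i\<ge>n. A i = A n"
begin

text \<open>The chain condition makes strict inclusion of annihilator ideals well-founded. A minimal
  choice inside \<open>I\<close> is minimal outright, since whatever lies below it also lies in
  \<open>I\<close>.\<close>

lemma min_annihilator_exists:
  assumes "annihilator_ideal R I" "I \<noteq> {\<zero>}"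
  obtains U where "min_annihilator U" "U \<subseteq> I"
proof -
  define r where "r = {(V, U). annihilator_ideal R V \<and> annihilator_ideal R U \<and> V \<subset> U}"
  have "wf r"
    unfolding wf_iff_no_infinite_down_chain
  proof
    assume "\<exists>f. \<forall>i. (f (Suc i), f i) \<in> r"
    then obtain f where f: "\<And>i. annihilator_ideal R (f i)" "\<And>i. f (Suc i) \<subset> f i"
      unfolding r_def by blast
    then obtain n where "\<forall>i\<ge>n. f i = f n"
      using dcc[of f] by blast
    then show False
      using f(2)[of n] by (metis le_SucI order_refl psubset_eq)
  qed
  then obtain U where "annihilator_ideal R U \<and> U \<noteq> {\<zero>} \<and> U \<subseteq> I"
    and "\<And>V. (V, U) \<in> r \<Longrightarrow> \<not> (annihilator_ideal R V \<and> V \<noteq> {\<zero>} \<and> V \<subseteq> I)"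
    using assms wfE_min[of r I "{V. annihilator_ideal R V \<and> V \<noteq> {\<zero>} \<and> V \<subseteq> I}"] by auto
  then show thesis
    by (intro that[of U]) (unfold min_annihilator_def r_def, blast+)
qed

text \<open>For infinitely many, the annihilators of the unions of the first \<open>n\<close> would
  descend strictly: \<open>U n\<close> kills all earlier ideals but, by reducedness, not
  itself.\<close>

lemma finite_min_annihilators: "finite {U. min_annihilator U}"
proof (rule ccontr)
  assume "infinite {U. min_annihilator U}"
  then obtain U :: "nat \<Rightarrow> 'a set" where U: "inj U" "\<And>i. min_annihilator (U i)"
    by (metis infinite_countable_subset mem_Collect_eq range_subsetD)
  have Ui: "ideal (U i) R" for i
    using U(2) by (rule min_annihilator_is_ideal)
  define A where "A n = annihilator R (\<Union>i<n. U i)" for n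
  have "\<exists>n. \<forall>i\<ge>n. A i = A n"
  proof (rule dcc)
    fix i
    show "annihilator_ideal R (A i)"
      unfolding A_def using ideal.Icarr[OF Ui] by (intro annihilator_ideal_annihilator) auto
    show "A (Suc i) \<subseteq> A i"
      unfolding A_def by (intro annihilator_antimono UN_mono) auto
  qed
  then obtain n where "A (Suc n) = A n"
    by (meson le_SucI order_refl)
  moreover have "U n \<subseteq> A n"
  proof
    fix x assume x: "x \<in> U n"
    have "x \<otimes> y = \<zero>" if "y \<in> U i" "i < n" for y i
      using min_annihilator_mult_zero[OF U(2) U(2) _ x that(1)] injD[OF U(1), of n i] that(2)
      by blast
    then show "x \<in> A n"
      using ideal.Icarr[OF Ui x] by (auto simp: A_def annihilator_def)
  qed
  moreover have "A (Suc n) \<subseteq> annihilator R (U n)"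
    unfolding A_def by (intro annihilator_antimono) auto
  ultimately have "U n = {\<zero>}"
    using ideal_subset_annihilator_imp_zero[OF Ui, of n "U n"] by blast
  then show False
    using U(2) by (auto simp: min_annihilator_def)
qed

text \<open>The double annihilator of \<open>I\<close> contains \<open>I\<close>, so it contains
  some minimal \<open>U\<close>. If \<open>I\<close> and \<open>U\<close> met trivially,
  \<open>U\<close> would lie in both the annihilator of \<open>I\<close> and the annihilator of
  that, hence be zero.\<close>

lemma ideal_meets_min_annihilator:
  assumes I: "ideal I R" "I \<noteq> {\<zero>}"
  obtains U where "min_annihilator U" "I \<inter> U \<noteq> {\<zero>}"
proof -
  have sub: "I \<subseteq> carrier R"
    using ideal.Icarr[OF I(1)] by blast
  have "annihilator R (annihilator R I) \<noteq> {\<zero>}"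
    using subset_annihilator_annihilator[OF sub] I ideal_zero_mem by blast
  then obtain U where U: "min_annihilator U" "U \<subseteq> annihilator R (annihilator R I)"
    using min_annihilator_exists[OF annihilator_ideal_annihilator[OF annihilator_subset]] by blast
  have "I \<inter> U \<noteq> {\<zero>}"
  proof
    assume "I \<inter> U = {\<zero>}"
    then have "U \<subseteq> annihilator R I"
      by (intro ideal_inter_zero_imp_annihilator min_annihilator_is_ideal U I) blast
    then have "U = {\<zero>}"
      using ideal_subset_annihilator_imp_zero min_annihilator_is_ideal U by blast
    then show False
      using U by (simp add: min_annihilator_def)
  qed
  with U(1) show thesis by (rule that)
qed

lemma finite_uniform_dimension_self_module: "finite_uniform_dimension R (self_module R)"
proof -
  \<comment> \<open>The uniform summands are all the minimal annihilator ideals, each listed once;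
    \<open>n\<close> is \<open>0\<close> for the zero ring.\<close>
  obtain U :: "nat \<Rightarrow> 'a set" and n where "bij_betw U {..<n} {U. min_annihilator U}"
    using ex_bij_betw_nat_finite[OF finite_min_annihilators] by (auto simp: atLeast0LessThan)
  then have inj: "inj_on U {..<n}" and im: "U ` {..<n} = {U. min_annihilator U}"
    by (auto simp: bij_betw_def)
  then have U: "min_annihilator (U i)" if "i \<in> {..<n}" for i
    using that by blast
  then have Ui: "ideal (U i) R" if "i \<in> {..<n}" for i
    using that by (intro min_annihilator_is_ideal)
  let ?S = "submodule_sum (self_module R) {..<n} U"
  have "essential_submodule ?S R (self_module R)"
    unfolding essential_submodule_def submodule_self_module_iff
  proof (intro conjI allI impI; (elim conjE)?)
    show "ideal ?S R"
      by (intro submodule_sum_self_module_is_ideal Ui) auto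
    fix K assume K: "ideal K R" "K \<noteq> {\<zero>\<^bsub>self_module R\<^esub>}"
    then obtain V where V: "min_annihilator V" "K \<inter> V \<noteq> {\<zero>}"
      by (auto simp: self_module_def elim: ideal_meets_min_annihilator)
    then obtain i where "i \<in> {..<n}" "V = U i"
      using im by blast
    then have "V \<subseteq> ?S"
      using ideal_subset_submodule_sum[of "{..<n}" U i] Ui by blast
    then show "K \<inter> ?S \<noteq> {\<zero>\<^bsub>self_module R\<^esub>}"
      using V ideal_zero_mem[OF K(1)] ideal_zero_mem[OF min_annihilator_is_ideal[OF V(1)]]
      by (auto simp: self_module_def)
  qed
  moreover have "independent_submodules (self_module R) {..<n} U"
    by (intro min_annihilators_independent U inj) auto
  ultimately show ?thesis
    unfolding finite_uniform_dimension_def has_uniform_dimension_def submodule_self_module_iff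
    using Ui U min_annihilator_uniform by blast
qed

end

end

end

theorem proposition3p25:
  fixes R :: "('a, 'm) ring_scheme"
  assumes "cring R"
    and "semiprime_ring R"
    and "monoartinian_ring R"
  shows "goldie_ring R"
proof -
  interpret cring R by (rule assms(1))
  \<comment> \<open>The two facts discharge, in order, the reducedness and chain hypotheses of the
    nested contexts.\<close>
  have "finite_uniform_dimension R (self_module R)"
    using semiprime_imp_reduced[OF assms(2)] monoartinian_annihilator_dcc[OF assms(3)]
    by (rule finite_uniform_dimension_self_module)
  then show ?thesis
    using monoartinian_acc_annihilator_ideals[OF assms(3)] by (simp add: goldie_ring_def)
qed

end
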